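(* Let $S$ be a metric space with Borel $\sigma$-algebra $\mathcal S$, and let $\Pi$ be a family of probability measures on $(S,\mathcal S)$. If $\Pi$ is tight, then $\Pi$ is relatively compact.
   Context: A family $\Pi$ of probability measures on $(S,\mathcal S)$ is tight if for every $\epsilon>0$ there exists a compact set $K\subset S$ such that $P(K)>1-\epsilon$ for all $P\in\Pi$. The family $\Pi$ is relatively compact if every sequence of elements of $\Pi$ contains a subsequence converging weakly to some probability measure on $(S,\mathcal S)$ (the limit may depend on the subsequence and need not lie in $\Pi$). Weak convergence $P_n\Rightarrow P$ means $\int f\,dP_n\to\int f\,dP$ for every bounded continuous $f:S\to\mathbb R$. *)

theory Defs
  imports "HOL-Probability.Probability"
begin

definition borel_prob_measures :: "'a::topological_space measure set" where
  "borel_prob_measures = {P. prob_space P \<and> sets P = sets borel}"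

text \<open>The library's \<open>weak_conv_m\<close> and \<open>tight\<close> only cover measures on the real line, the first via
  distribution functions and the second for sequences; the following are the notions for an
  arbitrary space.\<close>

definition weakly_converges :: "(nat \<Rightarrow> 'a::topological_space measure) \<Rightarrow> 'a measure \<Rightarrow> bool" where
  "weakly_converges X P \<longleftrightarrow>
     (\<forall>f :: 'a \<Rightarrow> real. continuous_on UNIV f \<and> bounded (range f) \<longrightarrow>
        (\<lambda>n. \<integral>x. f x \<partial>X n) \<longlonglongrightarrow> (\<integral>x. f x \<partial>P))"

definition tight_family :: "'a::topological_space measure set \<Rightarrow> bool" where
  "tight_family \<P> \<longleftrightarrow>
     (\<forall>\<epsilon>::real. \<epsilon> > 0 \<longrightarrow> (\<exists>K. compact K \<and> (\<forall>P\<in>\<P>. measure P K > 1 - \<epsilon>)))"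

definition relatively_compact_family :: "'a::topological_space measure set \<Rightarrow> bool" where
  "relatively_compact_family \<P> \<longleftrightarrow>
     (\<forall>X :: nat \<Rightarrow> 'a measure. (\<forall>n. X n \<in> \<P>) \<longrightarrow>
        (\<exists>r P. strict_mono (r :: nat \<Rightarrow> nat) \<and> P \<in> borel_prob_measures \<and>
               weakly_converges (X \<circ> r) P))"

end

theory Submission
  imports Defs
begin

text \<open>
  The real line already has Prokhorov's theorem: it is Helly's selection theorem in the form of
  \<open>tight_imp_convergent_subsubsequence\<close>. The idea is to transport it. Tightness provides
  compact sets \<open>K j\<close> that miss less than \<open>1 / Suc j\<close> of the mass of every measure in the given
  sequence, so all these measures are carried by \<open>U = (\<Union>j. K j)\<close>.

  By \<open>sigma_compact_real_coding\<close> there is a Borel function \<open>s\<close> into the reals, bounded on every \<open>K j\<close>,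
  with a left inverse \<open>\<phi>\<close> on \<open>U\<close> that is continuous on a closed set \<open>C \<supseteq> s ` U\<close>. Encoding
  may tear the space apart, because measures are pushed along \<open>s\<close> by measurability alone; only the
  decoder \<open>\<phi>\<close> has to be continuous. The images of the measures under \<open>s\<close> are tight, because \<open>s\<close> is bounded on
  each \<open>K j\<close>, so some subsequence of them converges weakly to a probability measure \<open>N\<close> on the reals. Since
  all the images live on the closed set \<open>C\<close>, so does \<open>N\<close> (\<open>weakly_converges_AE_closed\<close>), and its
  image under \<open>\<phi>\<close> is the limit sought: for a bounded continuous \<open>f\<close>, the function \<open>f \<circ> \<phi>\<close> on \<open>C\<close> has a
  bounded continuous extension \<open>g\<close> to the line by Tietze's theorem. The integral of \<open>g\<close> against the
  image of a measure under \<open>s\<close> is the integral of \<open>f\<close> against that measure, because \<open>\<phi> (s x) = x\<close>.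

  The code records first the least \<open>j\<close> with \<open>x \<in> K j\<close>, as an even integer, and then, as ternary
  digits, to which members of a countable family of small balls \<open>x\<close> belongs. Points with nearby codes lie
  in the same \<open>K j\<close> and share a small ball, which is what makes decoding continuous.
\<close>

section \<open>Coding a countable union of compact sets by real numbers\<close>

text \<open>
  Base 3 with digits 0 and 1, rather than base 2, keeps distinct bit sequences apart: the tail after the
  first difference cannot make up for that difference.
\<close>

definition bit_code :: "(nat \<Rightarrow> bool) \<Rightarrow> real" where
  "bit_code b = (\<Sum>m. of_bool (b m) * (1/3) ^ m)"

lemma summable_bit_code: "summable (\<lambda>m. of_bool (b m) * (1/3::real) ^ m)"
  by (rule summable_comparison_test[OF _ summable_geometric[of "1/3::real"]]) auto

lemma bit_code_nonneg: "0 \<le> bit_code b"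
  unfolding bit_code_def by (rule suminf_nonneg[OF summable_bit_code]) auto

lemma bit_code_le: "bit_code b \<le> 3/2"
proof -
  have "bit_code b \<le> (\<Sum>m. (1/3::real) ^ m)"
    unfolding bit_code_def
    by (rule suminf_le[OF _ summable_bit_code]) (auto intro: summable_geometric)
  also have "\<dots> = 3/2" by (subst suminf_geometric) auto
  finally show ?thesis .
qed

lemma bit_code_split_head:
  "bit_code b = (\<Sum>i<m. of_bool (b i) * (1/3) ^ i) + (1/3) ^ m * (of_bool (b m) + bit_code (\<lambda>i. b (Suc m + i)) / 3)"
proof -
  have "bit_code b = (\<Sum>i. of_bool (b (i + Suc m)) * (1/3) ^ (i + Suc m)) + (\<Sum>i<Suc m. of_bool (b i) * (1/3) ^ i)"
    unfolding bit_code_def by (rule suminf_split_initial_segment[OF summable_bit_code])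
  also have "(\<Sum>i. of_bool (b (i + Suc m)) * (1/3::real) ^ (i + Suc m))
      = (\<Sum>i. (1/3) ^ Suc m * (of_bool (b (Suc m + i)) * (1/3) ^ i))"
    by (simp add: power_add algebra_simps)
  also have "\<dots> = (1/3) ^ Suc m * bit_code (\<lambda>i. b (Suc m + i))"
    unfolding bit_code_def by (rule suminf_mult[OF summable_bit_code])
  finally show ?thesis by (simp add: algebra_simps)
qed

text \<open>
  At the first index \<open>k\<close> where the sequences differ the codes move apart by \<open>(1/3) ^ k\<close>, and the
  remaining digits can take back at most half of that. Hence closeness of codes forces agreement
  of an initial segment of bits.
\<close>

lemma bit_code_separates:
  assumes "m < M" "b m \<noteq> c m"
  shows "(1/3) ^ M \<le> \<bar>bit_code b - bit_code c\<bar>"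
proof -
  define k where "k = (LEAST i. b i \<noteq> c i)"
  have k: "b k \<noteq> c k" "k \<le> m" and below: "\<And>i. i < k \<Longrightarrow> b i = c i"
    using LeastI[of "\<lambda>i. b i \<noteq> c i" m] Least_le[of "\<lambda>i. b i \<noteq> c i" m] not_less_Least assms(2)
    unfolding k_def by blast+
  define B where "B = bit_code (\<lambda>i. b (Suc k + i))"
  define C where "C = bit_code (\<lambda>i. c (Suc k + i))"
  have BC: "0 \<le> B" "B \<le> 3/2" "0 \<le> C" "C \<le> 3/2"
    by (unfold B_def C_def, (rule bit_code_nonneg bit_code_le)+)
  have "(\<Sum>i<k. of_bool (b i) * (1/3::real) ^ i) = (\<Sum>i<k. of_bool (c i) * (1/3) ^ i)"
    using below by (intro sum.cong) auto
  then have "bit_code b - bit_code c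
      = (1/3) ^ k * (of_bool (b k) - of_bool (c k) + (B - C) / 3)"
    unfolding bit_code_split_head[of b k] bit_code_split_head[of c k] B_def C_def
    by (simp add: algebra_simps diff_divide_distrib)
  moreover have "1/2 \<le> \<bar>of_bool (b k) - of_bool (c k) + (B - C) / 3\<bar>"
    using k(1) BC by (cases "b k"; cases "c k") (auto simp: abs_if field_simps)
  ultimately have "(1/3) ^ k * (1/2) \<le> \<bar>bit_code b - bit_code c\<bar>"
    by (simp add: abs_mult)
  moreover have "(1/3::real) ^ M \<le> (1/3) ^ Suc k"
    using assms(1) k(2) by (intro power_decreasing) auto
  moreover have "(0::real) \<le> (1/3) ^ M" by simp
  ultimately show ?thesis unfolding power_Suc by linarith
qed

text \<open>
  The sets \<open>V m\<close> enumerate, for every \<open>j\<close> and \<open>k\<close>, a finite cover of \<open>K j\<close> by balls of radius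
  \<open>1 / Suc k\<close>. Uniformity of the index bound \<open>M\<close> over \<open>K j\<close> is what later turns agreement of finitely
  many membership bits into closeness of points.
\<close>

lemma sigma_compact_fine_open_sequence:
  fixes K :: "nat \<Rightarrow> 'a::metric_space set"
  assumes compact: "\<And>j. compact (K j)"
  shows "\<exists>V :: nat \<Rightarrow> 'a set. (\<forall>m. open (V m)) \<and>
    (\<forall>j. \<forall>\<epsilon>>0. \<exists>M. \<forall>x\<in>K j. \<exists>m<M. x \<in> V m \<and> (\<forall>y\<in>V m. dist x y < \<epsilon>))"
proof -
  have "\<exists>F. finite F \<and> K j \<subseteq> (\<Union>c\<in>F. ball c (1 / Suc k))" for j k
    using compact[of j] unfolding compact_eq_totally_bounded by (meson of_nat_0_less_iff zero_less_Suc zero_less_divide_1_iff)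
  then obtain F where F: "\<And>j k. finite (F j k)"
      "\<And>j k. K j \<subseteq> (\<Union>c\<in>F j k. ball c (1 / Suc k))"
    by metis
  \<comment> \<open>The empty set keeps the family nonempty, as its enumeration requires, when all \<open>K j\<close> are empty.\<close>
  define \<V> where "\<V> = insert {} (\<Union>j k. (\<lambda>c. ball c (1 / Suc k)) ` F j k)"
  have \<V>: "countable \<V>" "\<V> \<noteq> {}"
    unfolding \<V>_def by (auto intro: countable_finite[OF F(1)])
  define V where "V = from_nat_into \<V>"
  have range: "range V = \<V>"
    unfolding V_def using \<V> by (simp add: range_from_nat_into)
  show ?thesis
  proof (intro exI[of _ V] conjI allI impI)
    fix m
    have "V m \<in> \<V>" using range by auto
    then show "open (V m)" by (auto simp: \<V>_def)
  next
    fix j and \<epsilon> :: real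
    assume "\<epsilon> > 0"
    then obtain k where k: "1 / Suc k < \<epsilon> / 2"
      using nat_approx_posE[of "\<epsilon>/2"] by auto
    have "\<exists>m. V m = ball c (1 / Suc k)" if "c \<in> F j k" for c
    proof -
      have "ball c (1 / Suc k) \<in> range V" using that by (auto simp: range \<V>_def)
      then show ?thesis by auto
    qed
    then obtain i where i: "\<And>c. c \<in> F j k \<Longrightarrow> V (i c) = ball c (1 / Suc k)"
      by metis
    obtain M where M: "\<And>c. c \<in> F j k \<Longrightarrow> i c < M"
      using F(1)[of j k] finite_nat_set_iff_bounded[of "i ` F j k"] by auto
    have "\<exists>m<M. x \<in> V m \<and> (\<forall>y\<in>V m. dist x y < \<epsilon>)" if x: "x \<in> K j" for x
    proof -
      obtain c where c: "c \<in> F j k" "dist c x < 1 / Suc k"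
        using subsetD[OF F(2)[of j k] x] by auto
      have "dist x y < \<epsilon>" if "y \<in> V (i c)" for y
      proof -
        have "dist c y < 1 / Suc k" using that i c(1) by auto
        with c(2) k dist_triangle3[of x y c] show ?thesis by linarith
      qed
      then show ?thesis using c i M by (intro exI[of _ "i c"]) auto
    qed
    then show "\<exists>M. \<forall>x\<in>K j. \<exists>m<M. x \<in> V m \<and> (\<forall>y\<in>V m. dist x y < \<epsilon>)" by auto
  qed
qed

text \<open>
  The first hypothesis says that \<open>s\<close> is injective on \<open>U\<close> and that its inverse sends points converging to any
  \<open>t\<close> to a Cauchy family. The second hypothesis traps that family in a compact set, so that it has a limit
  even though the space may be incomplete. Regularity of metric spaces makes the pointwise extension continuous.
\<close>

lemma continuous_inverse_on_closure:
  fixes s :: "'a::metric_space \<Rightarrow> 'b::metric_space"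
  assumes cauchy: "\<And>t \<epsilon>. \<epsilon> > 0 \<Longrightarrow>
      \<exists>\<delta>>0. \<forall>x\<in>U. \<forall>y\<in>U. dist (s x) t < \<delta> \<longrightarrow> dist (s y) t < \<delta> \<longrightarrow> dist x y < \<epsilon>"
    and locally_compact: "\<And>t. \<exists>\<delta>>0. \<exists>K. compact K \<and> (\<forall>x\<in>U. dist (s x) t < \<delta> \<longrightarrow> x \<in> K)"
  obtains \<phi> where "continuous_on (closure (s ` U)) \<phi>" and "\<forall>x\<in>U. \<phi> (s x) = x"
proof -
  have inj: "inj_on s U"
  proof (rule inj_onI, rule ccontr)
    fix x y assume xy: "x \<in> U" "y \<in> U" "s x = s y" "x \<noteq> y"
    then show False using cauchy[of "dist x y" "s x"] by force
  qed
  define \<psi> where "\<psi> = the_inv_into U s"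
  have \<psi>: "\<psi> (s x) = x" if "x \<in> U" for x
    unfolding \<psi>_def using inj that by (rule the_inv_into_f_f)
  have cont: "continuous_on (s ` U) \<psi>"
    unfolding continuous_on_iff
  proof (intro ballI allI impI)
    fix t and \<epsilon> :: real assume "t \<in> s ` U" "\<epsilon> > 0"
    then obtain x where x: "x \<in> U" "t = s x" by auto
    obtain \<delta> where "\<delta> > 0" "\<forall>x\<in>U. \<forall>y\<in>U. dist (s x) t < \<delta> \<longrightarrow> dist (s y) t < \<delta> \<longrightarrow> dist x y < \<epsilon>"
      using cauchy[OF \<open>\<epsilon> > 0\<close>, of t] by auto
    then show "\<exists>d>0. \<forall>x'\<in>s ` U. dist x' t < d \<longrightarrow> dist (\<psi> x') (\<psi> t) < \<epsilon>"
      using x by (intro exI[of _ \<delta>]) (auto simp: \<psi>)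
  qed
  have lim: "\<exists>l. (\<psi> \<longlongrightarrow> l) (at t within s ` U)" if t: "t \<in> closure (s ` U)" for t
  proof -
    obtain z where z: "\<And>n. z n \<in> s ` U" "z \<longlonglongrightarrow> t"
      using t unfolding closure_sequential by auto
    then have "\<forall>n. \<exists>x. x \<in> U \<and> z n = s x" by auto
    then obtain y where y: "\<And>n. y n \<in> U" "\<And>n. z n = s (y n)" by metis
    obtain \<eta> K where \<eta>: "\<eta> > 0" and K: "compact K" "\<And>x. x \<in> U \<Longrightarrow> dist (s x) t < \<eta> \<Longrightarrow> x \<in> K"
      using locally_compact[of t] by auto
    obtain N where N: "\<And>n. n \<ge> N \<Longrightarrow> y n \<in> K"
      using z(2) \<eta> y K(2) unfolding lim_sequentially by metis
    obtain l r where r: "strict_mono (r::nat\<Rightarrow>nat)" "((\<lambda>n. y (n + N)) \<circ> r) \<longlonglongrightarrow> l"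
      using K(1)[unfolded compact_def, rule_format, of "\<lambda>n. y (n + N)"] N by auto
    have sz: "(\<lambda>n. s (y (r n + N))) \<longlonglongrightarrow> t"
      using LIMSEQ_subseq_LIMSEQ[OF LIMSEQ_ignore_initial_segment[OF z(2), of N] r(1)]
      by (simp add: o_def y(2))
    have "(\<psi> \<longlongrightarrow> l) (at t within s ` U)"
      unfolding Lim_within
    proof (intro allI impI)
      fix \<epsilon> :: real assume "\<epsilon> > 0"
      obtain \<delta> where \<delta>: "\<delta> > 0" "\<And>x y. x \<in> U \<Longrightarrow> y \<in> U \<Longrightarrow> dist (s x) t < \<delta> \<Longrightarrow> dist (s y) t < \<delta> \<Longrightarrow> dist x y < \<epsilon>/2"
        using cauchy[of "\<epsilon>/2" t] \<open>\<epsilon> > 0\<close> by auto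
      have "\<forall>\<^sub>F n in sequentially. dist (s (y (r n + N))) t < \<delta> \<and> dist (y (r n + N)) l < \<epsilon>/2"
        using tendstoD[OF sz \<delta>(1)] tendstoD[OF r(2), of "\<epsilon>/2"] \<open>\<epsilon> > 0\<close>
        by (auto simp: o_def elim: eventually_elim2)
      then obtain n where n: "dist (s (y (r n + N))) t < \<delta>" "dist (y (r n + N)) l < \<epsilon>/2"
        by (auto simp: eventually_sequentially)
      have "dist x l < \<epsilon>" if "x \<in> U" "dist (s x) t < \<delta>" for x
        using \<delta>(2)[OF that(1) y(1) that(2) n(1)] n(2) dist_triangle[of x l "y (r n + N)"] by linarith
      then show "\<exists>d>0. \<forall>x\<in>s ` U. 0 < dist x t \<and> dist x t < d \<longrightarrow> dist (\<psi> x) l < \<epsilon>"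
        using \<delta>(1) by (intro exI[of _ \<delta>]) (auto simp: \<psi>)
    qed
    then show ?thesis by blast
  qed
  have atin: "atin_within euclidean t (s ` U) = at t within s ` U" for t
    by (simp add: atin_within_def at_within_def nhdsin_def nhds_def)
  obtain \<phi> where "continuous_map (top_of_set (closure (s ` U))) euclidean \<phi>"
      "\<And>t. t \<in> s ` U \<Longrightarrow> \<phi> t = \<psi> t"
    by (rule continuous_map_extension_pointwise_alt[of euclidean "s ` U" "closure (s ` U)" euclidean \<psi>])
      (use cont lim in \<open>auto simp: regular_space_euclidean closure_subset atin\<close>)
  then show thesis using that \<psi> by auto
qed

text \<open>
  The decoder is continuous because, near any real \<open>t\<close>, all codes carry the same index \<open>ix\<close>, so that the
  coded points lie in a single \<open>K j\<close>, where finitely many bits determine a point up to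
  \<open>\<epsilon>\<close>. Boundedness of \<open>s\<close> on \<open>K j\<close> holds since the recorded index is the least one.
\<close>

lemma sigma_compact_real_coding:
  fixes K :: "nat \<Rightarrow> 'a::metric_space set"
  assumes compact: "\<And>j. compact (K j)"
  obtains s :: "'a \<Rightarrow> real" and \<phi> :: "real \<Rightarrow> 'a" and C
  where "s \<in> borel_measurable borel" and "closed C" and "continuous_on C \<phi>"
    and "\<forall>x\<in>\<Union>j. K j. s x \<in> C \<and> \<phi> (s x) = x"
    and "\<forall>j. bounded (s ` K j)"
proof -
  obtain V :: "nat \<Rightarrow> 'a set" where V: "\<And>m. open (V m)"
    "\<And>j \<epsilon>. \<epsilon> > 0 \<Longrightarrow> \<exists>M. \<forall>x\<in>K j. \<exists>m<M. x \<in> V m \<and> (\<forall>y\<in>V m. dist x y < \<epsilon>)"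
    using sigma_compact_fine_open_sequence[of K, OF compact] by blast
  define U where "U = (\<Union>j. K j)"
  define ix where "ix x = (LEAST j. x \<in> K j)" for x
  define code where "code x = bit_code (\<lambda>m. x \<in> V m)" for x
  \<comment> \<open>Bit codes have values in \<open>{0..3/2}\<close>, so the factor 2 leaves gaps of length \<open>1/2\<close> between the
    codes of points with different \<open>ix\<close>.\<close>
  define s where "s x = 2 * real (ix x) + code x" for x
  have ix: "x \<in> K (ix x)" if "x \<in> U" for x
    using that unfolding U_def ix_def by (auto intro: LeastI)
  have code: "0 \<le> code x" "code x \<le> 3/2" for x
    unfolding code_def by (rule bit_code_nonneg bit_code_le)+
  have [measurable]: "K j \<in> sets borel" "V m \<in> sets borel" for j m
    using compact[of j] V(1)[of m] by (auto intro: borel_compact)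
  have [measurable]: "ix \<in> borel \<rightarrow>\<^sub>M count_space UNIV"
    unfolding ix_def by measurable
  have "s \<in> borel_measurable borel"
    unfolding s_def code_def bit_code_def by measurable
  have same_ix: "ix x = ix y" if "\<bar>s x - s y\<bar> < 1/2" for x y
  proof (rule ccontr)
    assume "ix x \<noteq> ix y"
    then have "1 \<le> \<bar>real (ix x) - real (ix y)\<bar>" by linarith
    with that code[of x] code[of y] show False unfolding s_def by linarith
  qed
  have sep: "\<exists>\<delta>>0. \<forall>x\<in>U. \<forall>y\<in>U. dist (s x) t < \<delta> \<longrightarrow> dist (s y) t < \<delta> \<longrightarrow> dist x y < \<epsilon>"
    if \<epsilon>: "\<epsilon> > 0" for t \<epsilon>
  proof (cases "\<exists>z\<in>U. dist (s z) t < 1/4")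
    case False
    then show ?thesis by (intro exI[of _ "1/4"]) auto
  next
    case True
    then obtain z where z: "z \<in> U" "dist (s z) t < 1/4" by auto
    obtain M where M: "\<And>x. x \<in> K (ix z) \<Longrightarrow> \<exists>m<M. x \<in> V m \<and> (\<forall>y\<in>V m. dist x y < \<epsilon>)"
      using V(2)[OF \<epsilon>, of "ix z"] by auto
    define \<delta> where "\<delta> = min (1/4) ((1/3)^M / 2 :: real)"
    have "dist x y < \<epsilon>" if "x \<in> U" "y \<in> U" "dist (s x) t < \<delta>" "dist (s y) t < \<delta>" for x y
    proof -
      have d: "\<bar>s x - t\<bar> < 1/4" "\<bar>s y - t\<bar> < 1/4" "\<bar>s z - t\<bar> < 1/4"
        "\<bar>s x - t\<bar> < (1/3)^M / 2" "\<bar>s y - t\<bar> < (1/3)^M / 2"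
        using that z by (auto simp: \<delta>_def dist_real_def)
      have "ix x = ix z" "ix y = ix z"
        using same_ix[of x z] same_ix[of y z] d by linarith+
      then have "\<bar>code x - code y\<bar> < (1/3)^M" using d unfolding s_def by linarith
      then have agree: "x \<in> V m \<longleftrightarrow> y \<in> V m" if "m < M" for m
        using bit_code_separates[OF that, of "\<lambda>m. x \<in> V m" "\<lambda>m. y \<in> V m"] unfolding code_def by linarith
      show ?thesis using M[of x] ix[OF that(1)] \<open>ix x = ix z\<close> agree by metis
    qed
    moreover have "\<delta> > 0" by (simp add: \<delta>_def)
    ultimately show ?thesis by blast
  qed
  have loc: "\<exists>\<delta>>0. \<exists>L. compact L \<and> (\<forall>x\<in>U. dist (s x) t < \<delta> \<longrightarrow> x \<in> L)" for t
  proof (cases "\<exists>z\<in>U. dist (s z) t < 1/4")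
    case False
    then show ?thesis by (intro exI[of _ "1/4"]) (auto intro: exI[of _ "{}"])
  next
    case True
    then obtain z where z: "z \<in> U" "dist (s z) t < 1/4" by auto
    have "x \<in> K (ix z)" if "x \<in> U" "dist (s x) t < 1/4" for x
    proof -
      have "ix x = ix z" using same_ix[of x z] that z(2) unfolding dist_real_def by linarith
      then show ?thesis using ix[OF that(1)] by simp
    qed
    then show ?thesis using compact[of "ix z"]
      by (intro exI[of _ "1/4"]) auto
  qed
  obtain \<phi> where "continuous_on (closure (s ` U)) \<phi>" and "\<And>x. x \<in> U \<Longrightarrow> \<phi> (s x) = x"
    using continuous_inverse_on_closure[of U s, OF sep loc] by metis
  moreover have "bounded (s ` K j)" for j
  proof (rule boundedI)
    fix t assume "t \<in> s ` K j"
    then obtain x where x: "x \<in> K j" "t = s x" by auto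
    have "ix x \<le> j" unfolding ix_def by (rule Least_le) (rule x)
    then show "norm t \<le> 2 * real j + 3/2"
      using code[of x] by (simp add: x s_def)
  qed
  ultimately show thesis
    using \<open>s \<in> borel_measurable borel\<close> subsetD[OF closure_subset imageI, of _ U s]
    by (intro that[of s "closure (s ` U)" \<phi>]) (auto simp: U_def)
qed

section \<open>Weak limits on the real line\<close>

lemma weak_conv_m_imp_weakly_converges:
  assumes "\<And>n. real_distribution (X n)" "real_distribution M" "weak_conv_m X M"
  shows "weakly_converges X M"
  unfolding weakly_converges_def
proof (intro allI impI, elim conjE)
  fix f :: "real \<Rightarrow> real"
  assume f: "continuous_on UNIV f" "bounded (range f)"
  then obtain B where "\<And>x. norm (f x) \<le> B" unfolding bounded_iff by auto
  moreover have "isCont f x" for x using f(1) by (simp add: continuous_on_eq_continuous_at)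
  ultimately show "(\<lambda>n. integral\<^sup>L (X n) f) \<longlonglongrightarrow> integral\<^sup>L M f"
    using weak_conv_imp_integral_bdd_continuous_conv[OF assms] by blast
qed

text \<open>
  The truncated distance to \<open>C\<close> is a bounded continuous function whose integrals vanish along the
  sequence, hence also in the limit; its zero set is \<open>C\<close>.
\<close>

lemma weakly_converges_AE_closed:
  fixes X :: "nat \<Rightarrow> 'a::metric_space measure"
  assumes X: "\<And>n. X n \<in> borel_prob_measures" and M: "M \<in> borel_prob_measures"
    and conv: "weakly_converges X M" and C: "closed C" "\<And>n. AE x in X n. x \<in> C"
  shows "AE x in M. x \<in> C"
proof -
  interpret X: prob_space "X n" for n using X by (simp add: borel_prob_measures_def)
  interpret M: prob_space M using M by (simp add: borel_prob_measures_def)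
  have [measurable_cong]: "sets M = sets borel" using M by (simp add: borel_prob_measures_def)
  have ne: "C \<noteq> {}" using C(2)[of 0] X.AE_False by auto
  define g where "g x = min 1 (infdist x C)" for x
  have cont: "continuous_on UNIV g" unfolding g_def by (intro continuous_intros)
  then have [measurable]: "g \<in> borel_measurable borel" by (rule borel_measurable_continuous_onI)
  have g: "0 \<le> g x" "g x \<le> 1" for x by (auto simp: g_def infdist_nonneg)
  have "bounded (range g)" using g by (intro boundedI[of _ 1]) auto
  then have "(\<lambda>n. \<integral>x. g x \<partial>X n) \<longlonglongrightarrow> (\<integral>x. g x \<partial>M)"
    using conv cont by (simp add: weakly_converges_def)
  moreover have "(\<integral>x. g x \<partial>X n) = 0" for n
    using C(2)[of n] by (intro integral_eq_zero_AE) (auto simp: g_def)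
  ultimately have "(\<integral>x. g x \<partial>M) = 0" by (simp add: LIMSEQ_const_iff)
  moreover have "integrable M g" using g by (intro M.integrable_const_bound[of _ 1]) auto
  ultimately have "AE x in M. g x = 0"
    using integral_nonneg_eq_0_iff_AE[of M g] g by auto
  then show ?thesis
    by eventually_elim (use C(1) ne in \<open>auto simp: g_def in_closed_iff_infdist_zero min_def split: if_splits\<close>)
qed

section \<open>Transport back to the metric space\<close>

theorem theorem3p9:
  fixes \<P> :: "'a::metric_space measure set"
  assumes "\<P> \<subseteq> borel_prob_measures"
    and "tight_family \<P>"
  shows "relatively_compact_family \<P>"
  unfolding relatively_compact_family_def
proof (intro allI impI)
  fix X :: "nat \<Rightarrow> 'a measure"
  assume X\<P>: "\<forall>n. X n \<in> \<P>"
  have X: "prob_space (X n)" and X_sets[measurable_cong]: "sets (X n) = sets borel" for n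
    using X\<P> assms(1) by (auto simp: borel_prob_measures_def)
  interpret X: prob_space "X n" for n by (rule X)
  have "\<exists>K. compact K \<and> (\<forall>P\<in>\<P>. measure P K > 1 - 1 / Suc j)" for j
    using assms(2) unfolding tight_family_def by (metis of_nat_0_less_iff zero_less_Suc zero_less_divide_1_iff)
  then obtain K where K: "\<And>j. compact (K j)" "\<And>j n. measure (X n) (K j) > 1 - 1 / Suc j"
    using X\<P> by metis
  define U where "U = (\<Union>j. K j)"
  obtain s :: "'a \<Rightarrow> real" and C \<phi> where [measurable]: "s \<in> borel_measurable borel" and C: "closed C" "continuous_on C \<phi>"
    and s: "\<And>x. x \<in> U \<Longrightarrow> s x \<in> C \<and> \<phi> (s x) = x" and bdd: "\<And>j. bounded (s ` K j)"
    using sigma_compact_real_coding[of K, OF K(1), folded U_def] by metis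
  have K_sets[measurable]: "K j \<in> sets borel" for j using K(1) by (rule borel_compact)
  have [measurable]: "U \<in> sets borel" unfolding U_def by measurable
  have X_space: "space (X n) = UNIV" for n using sets_eq_imp_space_eq[OF X_sets] by simp
  have U_AE: "AE x in X n. x \<in> U" for n
  proof -
    have "measure (X n) U \<ge> 1 - 1 / Suc j" for j
      using K(2)[of j n] X.finite_measure_mono[of "K j" U n] by (fastforce simp: U_def)
    then have "1 \<le> measure (X n) U + \<epsilon>" if "\<epsilon> > 0" for \<epsilon>
      using nat_approx_posE[OF that] by (smt (verit, best))
    then have "X.prob n U = 1" using X.prob_le_1[of n U] field_le_epsilon by (meson antisym)
    then show ?thesis by (rule X.AE_prob_1)
  qed
  define \<mu> where "\<mu> n = distr (X n) borel s" for n
  have \<mu>: "real_distribution (\<mu> n)" for n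
    unfolding \<mu>_def by (rule X.real_distribution_distr) simp
  have "tight \<mu>"
    unfolding tight_def
  proof (intro conjI allI impI \<mu>)
    fix \<epsilon> :: real assume "\<epsilon> > 0"
    then obtain j where j: "1 / Suc j < \<epsilon>" using nat_approx_posE by blast
    obtain B where B: "B > 0" "\<And>x. x \<in> K j \<Longrightarrow> \<bar>s x\<bar> \<le> B"
      using bdd[of j] unfolding bounded_pos by auto
    \<comment> \<open>The interval is open on the left, so its lower end must lie strictly below \<open>-B\<close>.\<close>
    have "measure (\<mu> n) {-B-1<..B} > 1 - \<epsilon>" for n
    proof -
      have "s -` {-B-1<..B} \<in> sets borel" by (rule measurable_sets_borel[of s borel]) auto
      moreover have "K j \<subseteq> s -` {-B-1<..B}" using B(2) by force
      ultimately have "measure (X n) (K j) \<le> measure (\<mu> n) {-B-1<..B}"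
        unfolding \<mu>_def by (subst measure_distr) (auto intro!: X.finite_measure_mono simp: X_space X_sets)
      with K(2)[of j n] j show ?thesis by linarith
    qed
    then show "\<exists>a b. a < b \<and> (\<forall>n. 1 - \<epsilon> < measure (\<mu> n) {a<..b})"
      using B(1) by (intro exI[of _ "-B-1"] exI[of _ B]) auto
  qed
  then obtain r N where r: "strict_mono r" and N: "real_distribution N" and "weak_conv_m (\<mu> \<circ> id \<circ> r) N"
    using tight_imp_convergent_subsubsequence[of \<mu> id] by (auto simp: strict_mono_def)
  then have conv: "weakly_converges (\<lambda>n. \<mu> (r n)) N"
    by (intro weak_conv_m_imp_weakly_converges \<mu>) (auto simp: o_def)
  interpret N: real_distribution N by (rule N)
  have C_AE: "AE t in N. t \<in> C"
  proof (rule weakly_converges_AE_closed[OF _ _ conv C(1)])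
    show "\<mu> (r n) \<in> borel_prob_measures" for n
      using \<mu>[of "r n"] by (simp add: borel_prob_measures_def real_distribution_def real_distribution_axioms_def)
    show "N \<in> borel_prob_measures"
      by (simp add: borel_prob_measures_def N.prob_space_axioms)
    show "AE t in \<mu> (r n). t \<in> C" for n
      unfolding \<mu>_def using C(1) U_AE[of "r n"] s by (subst AE_distr_iff) auto
  qed
  \<comment> \<open>The value outside \<open>C\<close> is arbitrary, as \<open>N\<close> has no mass there; a constant keeps \<open>\<phi>'\<close> measurable.\<close>
  define \<phi>' where "\<phi>' t = (if t \<in> C then \<phi> t else undefined)" for t
  have [measurable]: "\<phi>' \<in> borel_measurable borel"
    unfolding \<phi>'_def using C by (intro borel_measurable_continuous_on_if) auto
  define P where "P = distr N borel \<phi>'"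
  have "weakly_converges (X \<circ> r) P"
    unfolding weakly_converges_def
  proof (intro allI impI, elim conjE)
    fix f :: "'a \<Rightarrow> real"
    assume f: "continuous_on UNIV f" "bounded (range f)"
    have [measurable]: "f \<in> borel_measurable borel" using f(1) by (rule borel_measurable_continuous_onI)
    obtain B where B: "B > 0" "\<And>x. norm (f x) \<le> B" using f(2) unfolding bounded_pos by auto
    have "continuous_on C (f \<circ> \<phi>)"
      using C(2) f(1) by (intro continuous_on_compose) (auto intro: continuous_on_subset)
    then obtain g where g: "continuous_on UNIV g" "\<And>t. t \<in> C \<Longrightarrow> g t = f (\<phi> t)" "\<And>t. norm (g t) \<le> B"
      using Tietze[of C "f \<circ> \<phi>" UNIV B] C(1) B by auto
    have [measurable]: "g \<in> borel_measurable borel" using g(1) by (rule borel_measurable_continuous_onI)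
    have "bounded (range g)" using g(3) by (intro boundedI[of _ B]) auto
    then have "(\<lambda>n. \<integral>t. g t \<partial>\<mu> (r n)) \<longlonglongrightarrow> (\<integral>t. g t \<partial>N)"
      using conv g(1) unfolding weakly_converges_def by blast
    moreover have "(\<integral>t. g t \<partial>\<mu> n) = (\<integral>x. f x \<partial>X n)" for n
    proof -
      have "(\<integral>t. g t \<partial>\<mu> n) = (\<integral>x. g (s x) \<partial>X n)"
        unfolding \<mu>_def by (rule integral_distr) auto
      also have "\<dots> = (\<integral>x. f x \<partial>X n)"
        using U_AE[of n] s g(2) by (intro integral_cong_AE) auto
      finally show ?thesis .
    qed
    moreover have "(\<integral>t. g t \<partial>N) = (\<integral>x. f x \<partial>P)"
    proof -
      have "(\<integral>x. f x \<partial>P) = (\<integral>t. f (\<phi>' t) \<partial>N)"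
        unfolding P_def by (rule integral_distr) auto
      also have "\<dots> = (\<integral>t. g t \<partial>N)"
      proof (rule integral_cong_AE)
        show "AE t in N. f (\<phi>' t) = g t"
          using C_AE by eventually_elim (simp add: \<phi>'_def g(2))
      qed simp_all
      finally show ?thesis by simp
    qed
    ultimately show "(\<lambda>n. \<integral>x. f x \<partial>(X \<circ> r) n) \<longlonglongrightarrow> (\<integral>x. f x \<partial>P)" by simp
  qed
  moreover have "P \<in> borel_prob_measures"
    unfolding P_def borel_prob_measures_def by (auto intro: N.prob_space_distr)
  ultimately show "\<exists>r P. strict_mono r \<and> P \<in> borel_prob_measures \<and> weakly_converges (X \<circ> r) P"
    using r by blast
qed

end
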